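(* Let $q=p^f\ge 3$ be an odd prime power. Let $\mathbb{F}_q^{\times}=\{x_1=1,x_2,\dots,x_{q-1}\}$ be an enumeration with $x_1=1$. For a nontrivial multiplicative character $\psi$ of $\mathbb{F}_q$ (complex valued, extended by $\psi(0)=0$), define $$D_q^{-}(\psi)=\left[\psi(x_j-x_i)\right]_{2\le i,j\le q-1},\qquad D_q^{+}(\psi)=\left[\psi(x_j+x_i)\right]_{2\le i,j\le q-1}.$$ Then $$\det D_q^{-}(\psi)=-\frac{1+\psi(-1)}{q^2}\,G_q(\psi)^{q-1},\qquad \det D_q^{+}(\psi)=\frac{(-1)^{(q+1)/2}\,\psi(-1)}{q^2}\left(2-\overline{\psi(2)}\right)G_q(\psi)^{q-1}.$$
   Context: $G_q(\psi)=\sum_{x\in\mathbb{F}_q}\psi(x)\zeta_p^{\mathrm{Tr}_{\mathbb{F}_q/\mathbb{F}_p}(x)}$ is the Gauss sum, where $\zeta_p$ is a primitive $p$-th root of unity in $\mathbb{C}$ and $\mathrm{Tr}$ is the trace map; $\overline{\cdot}$ denotes complex conjugation. *)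

theory Defs
  imports "Jordan_Normal_Form.Determinant" "HOL-Number_Theory.Residues" "HOL-Library.Cardinality"
begin

text \<open>
  Throughout, the finite field is a type of class \<^class>\<open>finite_field\<close> with \<open>p ^ f\<close> elements.
\<close>

definition multiplicative_character :: "('a::field \<Rightarrow> complex) \<Rightarrow> bool" where
  "multiplicative_character \<psi> \<longleftrightarrow>
     \<psi> 0 = 0 \<and> (\<forall>x. x \<noteq> 0 \<longrightarrow> \<psi> x \<noteq> 0) \<and>
     (\<forall>x y. x \<noteq> 0 \<longrightarrow> y \<noteq> 0 \<longrightarrow> \<psi> (x * y) = \<psi> x * \<psi> y)"

definition nontrivial_character :: "('a::field \<Rightarrow> complex) \<Rightarrow> bool" where
  "nontrivial_character \<psi> \<longleftrightarrow> (\<exists>x. x \<noteq> 0 \<and> \<psi> x \<noteq> 1)"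

definition primitive_root_of_unity :: "nat \<Rightarrow> complex \<Rightarrow> bool" where
  "primitive_root_of_unity n \<zeta> \<longleftrightarrow> \<zeta> ^ n = 1 \<and> (\<forall>k. 0 < k \<and> k < n \<longrightarrow> \<zeta> ^ k \<noteq> 1)"

text \<open>
  The trace of the extension of degree \<open>f\<close> of the prime field: the sum of the conjugates of \<open>x\<close>
  under the powers of the Frobenius automorphism.
\<close>
definition field_trace :: "nat \<Rightarrow> nat \<Rightarrow> 'a::field \<Rightarrow> 'a" where
  "field_trace p f x = (\<Sum>i<f. x ^ (p ^ i))"

text \<open>
  The trace lies in the prime field, which is embedded in the field as the image of
  \<open>{0,\<dots>,p - 1}\<close>; as an exponent it stands for its representative there (see
  \<open>trace_exponent\<close> below).
\<close>
definition trace_exponent :: "nat \<Rightarrow> nat \<Rightarrow> 'a::field \<Rightarrow> nat" where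
  "trace_exponent p f x = (THE k. k < p \<and> of_nat k = field_trace p f x)"

definition gauss_sum ::
    "nat \<Rightarrow> nat \<Rightarrow> complex \<Rightarrow> ('a::finite_field \<Rightarrow> complex) \<Rightarrow> complex" where
  "gauss_sum p f \<zeta> \<psi> = (\<Sum>x\<in>UNIV. \<psi> x * \<zeta> ^ trace_exponent p f x)"

text \<open>
  The elements \<open>x\<^sub>2, \<dots>, x\<^bsub>q-1\<^esub>\<close> occupy the rows and columns \<open>0, \<dots>, q - 3\<close>,
  since the matrices of the library are indexed from 0.
\<close>
definition D_minus :: "nat \<Rightarrow> (nat \<Rightarrow> 'a::field) \<Rightarrow> ('a \<Rightarrow> complex) \<Rightarrow> complex mat" where
  "D_minus q x \<psi> = mat (q - 2) (q - 2) (\<lambda>(i, j). \<psi> (x (j + 2) - x (i + 2)))"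

definition D_plus :: "nat \<Rightarrow> (nat \<Rightarrow> 'a::field) \<Rightarrow> ('a \<Rightarrow> complex) \<Rightarrow> complex mat" where
  "D_plus q x \<psi> = mat (q - 2) (q - 2) (\<lambda>(i, j). \<psi> (x (j + 2) + x (i + 2)))"

lemma finite_field_CHAR:
  assumes "prime p" "CARD('a::finite_field) = p ^ f"
  shows "CHAR('a) = p"
proof -
  have dvd: "CHAR('a) dvd p ^ f"
    using CHAR_dvd_CARD[where 'a = 'a] assms(2) by simp
  have "prime CHAR('a)" by (rule CHAR_prime)
  from this assms(1) prime_dvd_power[OF this dvd] show ?thesis
    by (rule primes_dvd_imp_eq)
qed

lemma field_trace_in_prime_field:
  assumes p: "prime p" and q: "CARD('a::finite_field) = p ^ f"
  shows "\<exists>!k. k < p \<and> of_nat k = field_trace p f (x::'a)"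
proof -
  have char: "CHAR('a) = p" by (rule finite_field_CHAR[OF p q])
  let ?t = "field_trace p f x"
  have "?t ^ p = (\<Sum>i<f. (x ^ (p ^ i)) ^ p)"
    unfolding field_trace_def by (rule freshmans_dream_sum) (simp_all only: char p)
  also have "\<dots> = (\<Sum>i<f. x ^ (p ^ Suc i))"
    by (simp add: power_mult [symmetric] mult.commute)
  also have "\<dots> = ?t + x ^ (p ^ f) - x"
    unfolding field_trace_def using sum.lessThan_Suc_shift[of "\<lambda>i. x ^ (p ^ i)" f]
      sum.lessThan_Suc[of "\<lambda>i. x ^ (p ^ i)" f] by (simp add: algebra_simps)
  also have "x ^ (p ^ f) = x" using finite_field_power_card_eq_same[of x] q by simp
  finally have t: "?t ^ p = ?t" by simp
  define P :: "'a poly" where "P = [:0, 1:] ^ p - [:0, 1:]"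
  have p1: "p > 1" using p prime_gt_1_nat by blast
  have degX: "degree ([:0, 1:] ^ p :: 'a poly) = p" by (simp add: degree_power_eq)
  have "degree P = p"
    unfolding P_def by (subst diff_conv_add_uminus, subst degree_add_eq_left) (use p1 in \<open>simp_all add: degX\<close>)
  hence degP: "degree P \<le> p" and P0: "P \<noteq> 0" using p1 by auto
  have rootsP: "poly P y = 0 \<longleftrightarrow> y ^ p = y" for y
    by (simp add: P_def)
  have inj: "inj_on (of_nat :: nat \<Rightarrow> 'a) {..<p}"
    by (rule inj_onI) (use char in \<open>auto simp: of_nat_eq_iff_cong_CHAR cong_def\<close>)
  have "(of_nat k :: 'a) ^ p = of_nat k" for k
  proof -
    have "[k ^ p = k] (mod p)"
    proof (cases "p dvd k")
      case True
      from True have "p dvd k ^ p" using p1 by (auto intro: dvd_trans[OF _ dvd_power])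
      with True show ?thesis by (simp add: cong_def mod_eq_0_iff_dvd)
    next
      case False
      hence "[k * k ^ (p - 1) = k * 1] (mod p)"
        using fermat_theorem[OF p] by (intro cong_scalar_left) auto
      thus ?thesis using p1 by (simp add: power_eq_if)
    qed
    hence "(of_nat (k ^ p) :: 'a) = of_nat k"
      using char by (simp only: of_nat_eq_iff_cong_CHAR)
    thus ?thesis by simp
  qed
  hence sub: "of_nat ` {..<p} \<subseteq> {y::'a. poly P y = 0}" by (auto simp: rootsP)
  have "card {y::'a. poly P y = 0} \<le> p"
    using card_poly_roots_bound[OF P0] degP by simp
  moreover have "card (of_nat ` {..<p} :: 'a set) = p"
    using card_image[OF inj] by simp
  ultimately have "of_nat ` {..<p} = {y::'a. poly P y = 0}"
    by (intro card_seteq[OF _ sub]) auto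
  with t have "?t \<in> of_nat ` {..<p}" by (simp add: rootsP)
  then obtain k where "k < p" "of_nat k = ?t" by auto
  moreover from this have "l = k" if "l < p" "of_nat l = ?t" for l
    using inj_onD[OF inj, of l k] that by simp
  ultimately show ?thesis by blast
qed

lemma trace_exponent:
  assumes "prime p" "CARD('a::finite_field) = p ^ f"
  shows "trace_exponent p f (x::'a) < p"
    and "of_nat (trace_exponent p f x) = field_trace p f x"
  using theI'[OF field_trace_in_prime_field[OF assms, of x]]
  unfolding trace_exponent_def by simp_all

end

theory Submission
  imports Defs
begin

text \<open>
  Both determinants are minors of the \<open>q \<times> q\<close> matrix \<open>C = [\<psi> (y + u x)]\<close> with \<open>u = -1\<close> or \<open>u = 1\<close>,
  obtained by deleting the rows and columns of 0 and 1. The additive characters diagonalise \<open>C\<close>,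
  up to the row permutation \<open>x \<mapsto> -u x\<close>, with eigenvalues \<open>cnj (\<psi> z) G\<close>. As the one at \<open>z = 0\<close>
  vanishes, replace \<open>C\<close> by \<open>C + s J\<close> with \<open>J\<close> the all-ones matrix and \<open>s \<noteq> 0\<close>: its determinant is
  \<open>\<plusminus> s q \<psi> (-1) G\<^sup>q\<^sup>-\<^sup>1\<close>, and the sums \<open>\<Sum>\<^sub>z \<psi> (z + a) cnj (\<psi> (z + b))\<close> show that its inverse is
  \<open>C\<^sup>* / q + J / (s q\<^sup>2)\<close>. Jacobi's identity for complementary minors then reduces the wanted minor
  to a \<open>2 \<times> 2\<close> determinant, and \<open>s \<rightarrow> 0\<close> gives the result.
\<close>

section \<open>Involutions without fixed points: sign of a permutation and Wilson's theorem\<close>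

text \<open>Orbits have exactly two elements, and what remains after removing one orbit is still
  stable under \<open>i\<close>.\<close>

lemma fixpoint_free_involution_induct [consumes 1, case_names involution empty pair]:
  assumes "finite S"
    and "\<And>x. x \<in> S \<Longrightarrow> i x \<in> S \<and> i (i x) = x \<and> i x \<noteq> x"
    and "P {}"
    and "\<And>a T. \<lbrakk>finite T; a \<notin> T; i a \<notin> T; i a \<noteq> a; i (i a) = a; P T\<rbrakk>
           \<Longrightarrow> P (insert a (insert (i a) T))"
  shows "P S"
  using assms(1,2)
proof (induction S rule: finite_psubset_induct)
  case (psubset S)
  show ?case
  proof (cases "S = {}")
    case True
    then show ?thesis using assms(3) by simp
  next
    case False
    then obtain a where a: "a \<in> S" by blast
    define T where "T = S - {a, i a}"
    have ia: "i a \<in> S" "i (i a) = a" "i a \<noteq> a" using psubset.prems[OF a] by auto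
    have "P T"
    proof (rule psubset.IH)
      show "T \<subset> S" using a by (auto simp: T_def)
      show "i x \<in> T \<and> i (i x) = x \<and> i x \<noteq> x" if "x \<in> T" for x
      proof -
        have "x \<in> S" "x \<noteq> a" "x \<noteq> i a" using that by (auto simp: T_def)
        moreover have x: "i x \<in> S" "i (i x) = x" "i x \<noteq> x"
          using psubset.prems[OF \<open>x \<in> S\<close>] by auto
        moreover have "i x \<noteq> a" using x(2) \<open>x \<noteq> i a\<close> by metis
        moreover have "i x \<noteq> i a" using x(2) ia(2) \<open>x \<noteq> a\<close> by metis
        ultimately show ?thesis by (simp add: T_def)
      qed
    qed
    then have "P (insert a (insert (i a) T))"
      using psubset.hyps ia by (intro assms(4)) (auto simp: T_def)
    moreover have "insert a (insert (i a) T) = S" using a ia by (auto simp: T_def)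
    ultimately show ?thesis by (simp only:)
  qed
qed

text \<open>Such a permutation is a product of disjoint transpositions, one for each orbit.\<close>

lemma sign_fixpoint_free_involution:
  assumes "finite S" "p permutes S"
    and inv: "\<And>x. x \<in> S \<Longrightarrow> p (p x) = x \<and> p x \<noteq> x"
  shows "sign p = (- 1) ^ (card S div 2)"
proof -
  \<comment> \<open>The restriction of \<open>p\<close> to a stable subset, extended by the identity
    so that it is again a permutation.\<close>
  define r where "r T = (\<lambda>x. if x \<in> T then p x else x)" for T
  have "r S permutes S \<and> sign (r S) = (- 1) ^ (card S div 2)"
    using assms(1)
  proof (induction S rule: fixpoint_free_involution_induct[where i = p])
    case (involution x)
    then show ?case using inv assms(2) by (simp add: permutes_in_image)
  next
    case empty
    have "r {} = id" by (simp add: r_def fun_eq_iff)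
    then show ?case by (simp only: permutes_id sign_id) simp
  next
    case (pair a T)
    let ?U = "insert a (insert (p a) T)"
    have perm: "r T permutes ?U"
      using pair.IH by (blast intro: permutes_subset)
    have tr: "transpose a (p a) permutes ?U" by (rule permutes_swap_id) auto
    have img: "p x \<noteq> a \<and> p x \<noteq> p a" if "x \<in> T" for x
    proof -
      have "p x \<in> T"
        using pair.IH that permutes_in_image[of "r T" T x] by (simp add: r_def)
      then show ?thesis using pair by auto
    qed
    have eq: "r ?U = transpose a (p a) \<circ> r T"
      using pair img by (auto simp: r_def fun_eq_iff transpose_def)
    have "sign (r ?U) = sign (transpose a (p a)) * sign (r T)"
      unfolding eq
    proof (rule sign_compose)
      show "permutation (transpose a (p a))" by (rule permutation_swap_id)
      show "permutation (r T)"
        using pair.IH pair.hyps(1) by (blast intro: permutes_imp_permutation)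
    qed
    moreover have "card ?U = card T + 2" using pair by simp
    ultimately have "sign (r ?U) = (- 1) ^ (card ?U div 2)"
      using pair by (simp add: sign_swap_id)
    moreover have "r ?U permutes ?U"
      unfolding eq by (rule permutes_compose[OF perm tr])
    ultimately show ?case by blast
  qed
  moreover have "r S = p"
    using assms(2) by (auto simp: r_def fun_eq_iff permutes_not_in)
  ultimately show ?thesis by simp
qed

text \<open>Pairing each element with its inverse cancels everything except the self-inverse
  elements 1 and -1.\<close>

lemma finite_field_wilson: "(\<Prod>x\<in>UNIV - {0}. x) = (- 1 :: 'a::finite_field)"
proof -
  define S where "S = UNIV - {0, 1, - 1 :: 'a}"
  have sq: "inverse x = x \<longleftrightarrow> x = 1 \<or> x = - 1" if "x \<noteq> 0" for x :: 'a
  proof -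
    have "inverse x = x \<longleftrightarrow> x * x = 1" using that by (auto simp: field_simps)
    then show ?thesis by (simp add: square_eq_1_iff)
  qed
  have "finite S" by simp
  then have S: "(\<Prod>x\<in>S. x) = 1"
  proof (induction S rule: fixpoint_free_involution_induct[where i = inverse])
    case (involution x)
    then show ?case using sq[of x] sq[of "inverse x"] by (auto simp: S_def inverse_eq_iff_eq)
  next
    case (pair a T)
    then have "a \<noteq> 0" by auto
    with pair show ?case by simp
  qed simp
  have "UNIV - {0} = {1, - 1} \<union> S" by (auto simp: S_def)
  then have "(\<Prod>x\<in>UNIV - {0}. x) = (\<Prod>x\<in>{1, - 1 :: 'a}. x) * (\<Prod>x\<in>S. x)"
    by (simp add: prod.union_disjoint S_def del: Un_insert_left)
  also have "(\<Prod>x\<in>{1, - 1 :: 'a}. x) = - 1"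
  proof (cases "1 = (- 1 :: 'a)")
    \<comment> \<open>In characteristic 2 the two self-inverse elements coincide and contribute a
      single factor.\<close>
    case True
    then have "{1, - 1 :: 'a} = {- 1}" by (simp only: insert_absorb2)
    then show ?thesis by (simp only: prod.insert) simp
  qed simp
  finally show ?thesis by (simp add: S)
qed

section \<open>Determinants: complementary minors and dependence on an additive shift\<close>

lemma index_mult_square_mat:
  assumes "A \<in> carrier_mat n n" "B \<in> carrier_mat n n" "i < n" "j < n"
  shows "(A * B) $$ (i, j) = (\<Sum>k<n. A $$ (i, k) * B $$ (k, j))"
  using assms by (auto simp: scalar_prod_def atLeast0LessThan intro!: sum.cong)

text \<open>Let \<open>?N\<close> be \<open>B\<close> with its last \<open>n\<close> columns
  replaced by unit vectors. Then \<open>A * ?N\<close> has the first \<open>m\<close> columns of the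
  identity and the last \<open>n\<close> columns of \<open>A\<close>. Both matrices are block
  triangular, so taking determinants gives the claim.\<close>

lemma det_complementary_minor:
  fixes A B :: "'a::idom mat"
  assumes A: "A \<in> carrier_mat (m + n) (m + n)" and B: "B \<in> carrier_mat (m + n) (m + n)"
    and AB: "A * B = 1\<^sub>m (m + n)"
  shows "det (mat n n (\<lambda>(i, j). A $$ (i + m, j + m))) =
         det A * det (mat m m (\<lambda>(i, j). B $$ (i, j)))"
proof -
  let ?X = "mat m m (\<lambda>(i, j). B $$ (i, j))"
  let ?Z = "mat n m (\<lambda>(i, j). B $$ (i + m, j))"
  let ?Q = "mat m n (\<lambda>(i, j). A $$ (i, j + m))"
  let ?S = "mat n n (\<lambda>(i, j). A $$ (i + m, j + m))"
  let ?N = "four_block_mat ?X (0\<^sub>m m n) ?Z (1\<^sub>m n)"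
  let ?M = "four_block_mat (1\<^sub>m m) ?Q (0\<^sub>m n m) ?S"
  have N: "?N \<in> carrier_mat (m + n) (m + n)" by (simp add: carrier_matI)
  have "A * ?N = ?M"
  proof (rule eq_matI)
    fix i j assume "i < dim_row ?M" "j < dim_col ?M"
    then have ij: "i < m + n" "j < m + n" by simp_all
    have "(A * ?N) $$ (i, j) = (\<Sum>k<m + n. A $$ (i, k) * ?N $$ (k, j))"
      by (rule index_mult_square_mat[OF A N ij])
    also have "\<dots> = ?M $$ (i, j)"
    proof (cases "j < m")
      case True
      have "(\<Sum>k<m + n. A $$ (i, k) * ?N $$ (k, j)) = (\<Sum>k<m + n. A $$ (i, k) * B $$ (k, j))"
        using True by (intro sum.cong) auto
      also have "\<dots> = (A * B) $$ (i, j)"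
        by (rule index_mult_square_mat[OF A B ij, symmetric])
      finally show ?thesis using True ij by (simp add: AB)
    next
      case False
      have "(\<Sum>k<m + n. A $$ (i, k) * ?N $$ (k, j)) =
            (\<Sum>k<m + n. if k = j then A $$ (i, k) else 0)"
        using False ij by (intro sum.cong) auto
      also have "\<dots> = A $$ (i, j)" using ij by simp
      finally show ?thesis using False ij by auto
    qed
    finally show "(A * ?N) $$ (i, j) = ?M $$ (i, j)" .
  qed (use A in auto)
  moreover have "det ?N = det ?X"
    by (subst det_four_block_mat_upper_right_zero[of _ m _ n]) auto
  moreover have "det ?M = det ?S"
    by (subst det_four_block_mat_lower_left_zero[of _ m _ n]) auto
  ultimately show ?thesis using det_mult[OF A N] by simp
qed

lemma det_2x2:
  fixes A :: "'a::comm_ring_1 mat"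
  assumes "A \<in> carrier_mat 2 2"
  shows "det A = A $$ (0, 0) * A $$ (1, 1) - A $$ (0, 1) * A $$ (1, 0)"
proof -
  have "det A = (\<Sum>i<2. A $$ (i, 0) * cofactor A i 0)"
    using assms by (rule laplace_expansion_column) simp
  moreover have "det (mat_delete A i 0) = A $$ (1 - i, 1)" if "i < 2" for i
    using assms that mat_delete_carrier[OF assms, of i 0]
    by (subst det_single) (auto simp: mat_delete_def less_2_cases_iff)
  ultimately show ?thesis
    by (simp add: cofactor_def numeral_2_eq_2 algebra_simps)
qed

text \<open>By the Leibniz formula the determinant is a polynomial in \<open>s\<close>. This later
  permits the limit at 0.\<close>

lemma continuous_det_add_const:
  fixes c :: "nat \<Rightarrow> nat \<Rightarrow> complex"
  shows "continuous_on UNIV (\<lambda>s. det (mat n n (\<lambda>(i, j). c i j + s)))"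
proof -
  have "det (mat n n (\<lambda>(i, j). c i j + s)) =
        (\<Sum>p | p permutes {0..<n}. signof p * (\<Prod>i = 0..<n. c i (p i) + s))" for s
    by (subst det_def'[of _ n])
       (auto intro!: sum.cong prod.cong simp: permutes_in_image dest: permutes_in_image)
  then show ?thesis by (simp only:) (intro continuous_intros)
qed

section \<open>Multiplicative characters and their correlation sums\<close>

lemma multiplicative_character_mult:
  assumes "multiplicative_character \<psi>"
  shows "\<psi> (x * y) = \<psi> x * \<psi> y"
  using assms unfolding multiplicative_character_def by (metis mult_zero_left mult_zero_right)

lemma multiplicative_character_one:
  assumes "multiplicative_character \<psi>"
  shows "\<psi> 1 = 1"
proof -
  have "\<psi> 1 * \<psi> 1 = \<psi> 1 * 1"
    using multiplicative_character_mult[OF assms, of 1 1] by simp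
  moreover have "\<psi> 1 \<noteq> 0" using assms by (simp add: multiplicative_character_def)
  ultimately show ?thesis by simp
qed

lemma multiplicative_character_power:
  assumes "multiplicative_character \<psi>"
  shows "\<psi> (x ^ n) = \<psi> x ^ n"
  by (induction n)
     (simp_all add: multiplicative_character_mult[OF assms] multiplicative_character_one[OF assms])

lemma multiplicative_character_prod:
  assumes "multiplicative_character \<psi>"
  shows "\<psi> (\<Prod>x\<in>S. g x) = (\<Prod>x\<in>S. \<psi> (g x))"
  by (induction S rule: infinite_finite_induct)
     (simp_all add: multiplicative_character_mult[OF assms] multiplicative_character_one[OF assms])

text \<open>A nonzero \<open>x\<close> satisfies \<open>x ^ (q - 1) = 1\<close>, so its value is a
  root of unity and has norm 1.\<close>

lemma multiplicative_character_mult_cnj: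
  fixes \<psi> :: "'a::finite_field \<Rightarrow> complex"
  assumes "multiplicative_character \<psi>" "x \<noteq> 0"
  shows "\<psi> x * cnj (\<psi> x) = 1"
proof -
  let ?q = "CARD('a)"
  have "card {0, 1 :: 'a} \<le> ?q" by (rule card_mono) auto
  then have q: "?q > 1" by simp
  have "x * x ^ (?q - 1) = x * 1"
    using finite_field_power_card_eq_same[of x] q by (simp flip: power_Suc)
  then have "x ^ (?q - 1) = 1" using assms(2) by (metis mult_left_cancel)
  then have "\<psi> x ^ (?q - 1) = 1"
    by (metis multiplicative_character_power multiplicative_character_one assms(1))
  then have "norm (\<psi> x) ^ (?q - 1) = 1" by (metis norm_power norm_one)
  then have "norm (\<psi> x) = 1" using q by (intro power_eq_imp_eq_base[of _ "?q - 1" 1]) auto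
  then show ?thesis by (simp add: complex_norm_square[symmetric])
qed

lemma sum_nontrivial_character:
  fixes \<psi> :: "'a::finite_field \<Rightarrow> complex"
  assumes "multiplicative_character \<psi>" "nontrivial_character \<psi>"
  shows "(\<Sum>x\<in>UNIV. \<psi> x) = 0"
proof -
  obtain c where c: "c \<noteq> 0" "\<psi> c \<noteq> 1" using assms(2) by (auto simp: nontrivial_character_def)
  have "(\<Sum>x\<in>UNIV. \<psi> x) = (\<Sum>x\<in>UNIV. \<psi> (c * x))"
    by (rule sum.reindex_bij_witness[of _ "\<lambda>x. c * x" "\<lambda>x. x / c"]) (use c in auto)
  also have "\<dots> = \<psi> c * (\<Sum>x\<in>UNIV. \<psi> x)"
    by (simp add: multiplicative_character_mult[OF assms(1)] sum_distrib_left)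
  finally have "(1 - \<psi> c) * (\<Sum>x\<in>UNIV. \<psi> x) = 0" by (simp add: algebra_simps)
  then show ?thesis using c by simp
qed

text \<open>After the substitution \<open>w = z + b\<close>, the summand for
  \<open>w \<noteq> 0\<close> is the value at \<open>1 + (a - b) / w\<close>. For
  \<open>a \<noteq> b\<close> this argument runs once through every element except 1, so the
  vanishing full sum lacks only \<open>\<psi> 1 = 1\<close>.\<close>

lemma sum_character_shift_cnj:
  fixes \<psi> :: "'a::finite_field \<Rightarrow> complex"
  assumes "multiplicative_character \<psi>" "nontrivial_character \<psi>"
  shows "(\<Sum>z\<in>UNIV. \<psi> (z + a) * cnj (\<psi> (z + b))) = (if a = b then of_nat CARD('a) else 0) - 1"
proof -
  note mc = assms(1)
  have zero: "\<psi> 0 = 0" using mc by (simp add: multiplicative_character_def)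
  have "(\<Sum>z\<in>UNIV. \<psi> (z + a) * cnj (\<psi> (z + b))) = (\<Sum>w\<in>UNIV. \<psi> (w + (a - b)) * cnj (\<psi> w))"
    by (rule sum.reindex_bij_witness[of _ "\<lambda>w. w - b" "\<lambda>z. z + b"]) (auto simp: algebra_simps)
  also have "\<dots> = (\<Sum>w\<in>UNIV - {0}. \<psi> (w + (a - b)) * cnj (\<psi> w))"
    by (rule sum.mono_neutral_right) (auto simp: zero)
  also have "\<dots> = (\<Sum>w\<in>UNIV - {0}. \<psi> (1 + (a - b) / w))"
  proof (rule sum.cong)
    fix w :: 'a assume "w \<in> UNIV - {0}"
    then have w: "w \<noteq> 0" by simp
    then have "w + (a - b) = (1 + (a - b) / w) * w" by (simp add: field_simps)
    then have "\<psi> (w + (a - b)) = \<psi> (1 + (a - b) / w) * \<psi> w"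
      by (simp only: multiplicative_character_mult[OF mc])
    then show "\<psi> (w + (a - b)) * cnj (\<psi> w) = \<psi> (1 + (a - b) / w)"
      using multiplicative_character_mult_cnj[OF mc w] by (simp add: mult.assoc)
  qed simp
  also have "\<dots> = (if a = b then of_nat CARD('a) else 0) - 1"
  proof (cases "a = b")
    case True
    have "CARD('a) \<ge> 1" by (simp add: Suc_leI)
    then show ?thesis using True
      by (simp add: multiplicative_character_one[OF mc] card_Diff_singleton of_nat_diff)
  next
    case False
    have "(\<Sum>w\<in>UNIV - {0}. \<psi> (1 + (a - b) / w)) = (\<Sum>u\<in>UNIV - {1}. \<psi> u)"
      by (rule sum.reindex_bij_witness[of _ "\<lambda>u. (a - b) / (u - 1)" "\<lambda>w. 1 + (a - b) / w"])
         (use False in auto)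
    also have "\<dots> = (\<Sum>u\<in>UNIV. \<psi> u) - \<psi> 1" by (subst sum_diff1) auto
    finally show ?thesis
      using False by (simp add: sum_nontrivial_character[OF assms] multiplicative_character_one[OF mc])
  qed
  finally show ?thesis .
qed

section \<open>The additive character given by the trace, and Gauss sums\<close>

definition trace_character :: "nat \<Rightarrow> nat \<Rightarrow> complex \<Rightarrow> 'a::finite_field \<Rightarrow> complex" where
  "trace_character p f \<zeta> x = \<zeta> ^ trace_exponent p f x"

text \<open>The trace is additive by the freshman's dream, and the exponent of
  \<open>\<zeta>\<close> matters only modulo \<open>p\<close>.\<close>

lemma trace_character_add:
  fixes x y :: "'a::finite_field"
  assumes p: "prime p" and q: "CARD('a) = p ^ f" and \<zeta>: "primitive_root_of_unity p \<zeta>"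
  shows "trace_character p f \<zeta> (x + y) = trace_character p f \<zeta> x * trace_character p f \<zeta> y"
proof -
  have char: "CHAR('a) = p" by (rule finite_field_CHAR[OF p q])
  have "field_trace p f (x + y) = field_trace p f x + field_trace p f y"
    unfolding field_trace_def sum.distrib[symmetric]
    by (rule sum.cong) (auto simp: freshmans_dream' char p)
  then have "of_nat (trace_exponent p f (x + y)) =
             (of_nat (trace_exponent p f x + trace_exponent p f y) :: 'a)"
    by (simp add: trace_exponent(2)[OF p q])
  then have *: "[trace_exponent p f (x + y) = trace_exponent p f x + trace_exponent p f y] (mod p)"
    by (simp only: of_nat_eq_iff_cong_CHAR char)
  have "\<zeta> ^ k = \<zeta> ^ (k mod p)" for k
  proof -
    have "\<zeta> ^ k = (\<zeta> ^ p) ^ (k div p) * \<zeta> ^ (k mod p)"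
      by (simp flip: power_mult power_add)
    then show ?thesis using \<zeta> by (simp add: primitive_root_of_unity_def)
  qed
  then show ?thesis using * unfolding trace_character_def by (metis cong_def power_add)
qed

text \<open>The trace is a nonzero polynomial of degree at most \<open>p ^ (f - 1)\<close>, too
  small for all \<open>p ^ f\<close> elements to be roots.\<close>

lemma field_trace_nonzero:
  assumes p: "prime p" and q: "CARD('a::finite_field) = p ^ f" and f: "f > 0"
  shows "\<exists>x::'a. field_trace p f x \<noteq> 0"
proof (rule ccontr)
  assume *: "\<nexists>x::'a. field_trace p f x \<noteq> 0"
  define P :: "'a poly" where "P = (\<Sum>i<f. Polynomial.monom 1 (p ^ i))"
  have p1: "p > 1" using p prime_gt_1_nat by blast
  have "poly P x = 0" for x using * by (simp add: P_def poly_sum poly_monom field_trace_def)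
  then have roots: "{x. poly P x = 0} = UNIV" by auto
  \<comment> \<open>Only the summand \<open>i = 0\<close> has a linear term, which shows that
    \<open>P\<close> is not the zero polynomial.\<close>
  have "poly.coeff P 1 = (\<Sum>i<f. if i = 0 then 1 else 0)"
    using p1 unfolding P_def coeff_sum by (intro sum.cong) auto
  then have "poly.coeff P 1 = 1" using f by simp
  then have "P \<noteq> 0" by auto
  then have "p ^ f \<le> degree P" using card_poly_roots_bound[of P] q by (simp add: roots)
  also have "degree P \<le> p ^ (f - 1)"
    unfolding P_def
  proof (rule degree_sum_le)
    fix i assume "i \<in> {..<f}"
    then have "p ^ i \<le> p ^ (f - 1)" using p1 by (intro power_increasing) auto
    then show "degree (Polynomial.monom 1 (p ^ i) :: 'a poly) \<le> p ^ (f - 1)"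
      using degree_monom_le order_trans by blast
  qed simp
  also have "\<dots> < p ^ f" using p1 f by (intro power_strict_increasing) auto
  finally show False by simp
qed

text \<open>Orthogonality: some \<open>c\<close> has nonzero trace, so its exponent lies strictly
  between 0 and \<open>p\<close>, and primitivity of \<open>\<zeta>\<close> makes the character
  nontrivial.\<close>

lemma sum_trace_character:
  fixes z :: "'a::finite_field"
  assumes p: "prime p" and q: "CARD('a) = p ^ f" and f: "f > 0"
    and \<zeta>: "primitive_root_of_unity p \<zeta>"
  shows "(\<Sum>x\<in>UNIV. trace_character p f \<zeta> (x * z)) = (if z = 0 then of_nat CARD('a) else 0)"
proof (cases "z = 0")
  case True
  \<comment> \<open>The value at 0 is idempotent and, being a power of
    \<open>\<zeta> \<noteq> 0\<close>, nonzero; hence it is 1.\<close>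
  have "trace_character p f \<zeta> (0 :: 'a) = trace_character p f \<zeta> (0 :: 'a) * trace_character p f \<zeta> (0 :: 'a)"
    using trace_character_add[OF p q \<zeta>, of 0 0] by simp
  moreover have "\<zeta> \<noteq> 0"
    using \<zeta> p prime_gt_0_nat[OF p] by (auto simp: primitive_root_of_unity_def power_0_left)
  ultimately show ?thesis using True by (simp add: trace_character_def)
next
  case False
  obtain c :: 'a where c: "field_trace p f c \<noteq> 0" using field_trace_nonzero[OF p q f] by blast
  have "trace_exponent p f c \<noteq> 0" using trace_exponent(2)[OF p q, of c] c by (metis of_nat_0)
  then have c1: "trace_character p f \<zeta> c \<noteq> 1"
    using trace_exponent(1)[OF p q, of c] \<zeta>
    by (simp add: trace_character_def primitive_root_of_unity_def)
  let ?s = "\<Sum>x\<in>UNIV. trace_character p f \<zeta> (x :: 'a)"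
  have "?s = (\<Sum>x\<in>UNIV. trace_character p f \<zeta> (c + x))"
    by (rule sum.reindex_bij_witness[of _ "\<lambda>x. c + x" "\<lambda>x. x - c"]) auto
  also have "\<dots> = trace_character p f \<zeta> c * ?s"
    by (simp add: trace_character_add[OF p q \<zeta>] sum_distrib_left)
  finally have "(1 - trace_character p f \<zeta> c) * ?s = 0" by (simp add: algebra_simps)
  then have "?s = 0" using c1 by simp
  moreover have "(\<Sum>x\<in>UNIV. trace_character p f \<zeta> (x * z)) = ?s"
    by (rule sum.reindex_bij_witness[of _ "\<lambda>x. x / z" "\<lambda>x. x * z"]) (use False in auto)
  ultimately show ?thesis using False by simp
qed

text \<open>For \<open>z \<noteq> 0\<close>, replacing \<open>t\<close> by \<open>t / z\<close>
  pulls out the inverse of \<open>\<psi> z\<close>, which is its conjugate. For \<open>z = 0\<close>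
  both sides vanish.\<close>

lemma sum_character_trace_character:
  fixes z :: "'a::finite_field"
  assumes "multiplicative_character \<psi>" "nontrivial_character \<psi>"
    and "prime p" "CARD('a) = p ^ f" "f > 0" "primitive_root_of_unity p \<zeta>"
  shows "(\<Sum>t\<in>UNIV. \<psi> t * trace_character p f \<zeta> (t * z)) = cnj (\<psi> z) * gauss_sum p f \<zeta> \<psi>"
proof (cases "z = 0")
  case True
  have "trace_character p f \<zeta> (0::'a) * of_nat CARD('a) = of_nat CARD('a)"
    using sum_trace_character[OF assms(3-6), of 0] by (simp add: mult.commute)
  then have "trace_character p f \<zeta> (0::'a) = 1" by simp
  moreover have "\<psi> 0 = 0" using assms(1) by (simp add: multiplicative_character_def)
  ultimately show ?thesis
    using True sum_nontrivial_character[OF assms(1,2)] by simp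
next
  case False
  have "(\<Sum>t\<in>UNIV. \<psi> t * trace_character p f \<zeta> (t * z)) =
        (\<Sum>t\<in>UNIV. \<psi> (t / z) * trace_character p f \<zeta> t)"
    by (rule sum.reindex_bij_witness[of _ "\<lambda>t. t / z" "\<lambda>t. t * z"]) (use False in auto)
  also have "\<dots> = cnj (\<psi> z) * gauss_sum p f \<zeta> \<psi>"
    unfolding gauss_sum_def sum_distrib_left trace_character_def[symmetric]
  proof (rule sum.cong)
    fix t :: 'a
    have "\<psi> (t / z) * \<psi> z = \<psi> t"
      using False by (simp flip: multiplicative_character_mult[OF assms(1)])
    then have "\<psi> (t / z) = cnj (\<psi> z) * \<psi> t"
      using multiplicative_character_mult_cnj[OF assms(1) False]
      by (metis mult.assoc mult.commute mult.right_neutral)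
    then show "\<psi> (t / z) * trace_character p f \<zeta> t = cnj (\<psi> z) * (\<psi> t * trace_character p f \<zeta> t)"
      by simp
  qed simp
  finally show ?thesis .
qed

section \<open>Diagonalisation of the full matrix by additive characters\<close>

text \<open>The enumeration \<open>h\<close> puts 0 and 1 at the indices 0 and 1, so that the rows
  and columns to be deleted are the first two.\<close>

locale enumerated_field_characters =
  fixes p f q :: nat and h :: "nat \<Rightarrow> 'a::finite_field" and \<psi> :: "'a \<Rightarrow> complex" and \<zeta> :: complex
  assumes p: "prime p" and card: "CARD('a) = p ^ f" and q: "CARD('a) = q" and f: "f > 0"
    and \<zeta>: "primitive_root_of_unity p \<zeta>"
    and mc: "multiplicative_character \<psi>" and nontrivial: "nontrivial_character \<psi>"
    and bij: "bij_betw h {..<q} UNIV" and h0: "h 0 = 0" and h1: "h 1 = 1"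
begin

abbreviation G :: complex where "G \<equiv> gauss_sum p f \<zeta> \<psi>"
abbreviation e :: "'a \<Rightarrow> complex" where "e \<equiv> trace_character p f \<zeta>"

text \<open>
  The additive shift by \<open>s\<close> makes the singular matrix of the values \<open>\<psi> (y + u x)\<close> invertible.
\<close>
text \<open>
  The additive shift by \<open>s\<close> makes the singular matrix of the values \<open>\<psi> (y + u x)\<close> invertible.
\<close>
text \<open>
  The additive shift by \<open>s\<close> makes the singular matrix of the values \<open>\<psi> (y + u x)\<close> invertible.
\<close>
text \<open>
  The additive shift by \<open>s\<close> makes the singular matrix of the values \<open>\<psi> (y + u x)\<close> invertible.
\<close>
definition M :: "'a \<Rightarrow> complex \<Rightarrow> complex mat" where
  "M u s = mat q q (\<lambda>(i, j). \<psi> (h j + u * h i) + s)"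

text \<open>\<open>F 1\<close> is the Fourier matrix of the additive group; for
  \<open>v \<noteq> 0\<close>, \<open>F v\<close> arises from it by permuting the rows along
  multiplication by \<open>v\<close>.\<close>

definition F :: "'a \<Rightarrow> complex mat" where
  "F v = mat q q (\<lambda>(i, j). e (v * h i * h j))"

text \<open>Index 0 belongs to the trivial additive character, the only one that sees the shift
  \<open>s\<close>; there the sum of \<open>\<psi>\<close> itself vanishes.\<close>

definition eigenvalue :: "complex \<Rightarrow> nat \<Rightarrow> complex" where
  "eigenvalue s i = (if i = 0 then s * of_nat q else cnj (\<psi> (h i)) * G)"

lemma carrier [simp]: "M u s \<in> carrier_mat q q" "F v \<in> carrier_mat q q"
  by (simp_all add: M_def F_def)

lemma psi_0 [simp]: "\<psi> 0 = 0"
  using mc by (simp add: multiplicative_character_def)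

lemma psi_1 [simp]: "\<psi> 1 = 1"
  by (rule multiplicative_character_one[OF mc])

lemma q_ge_2: "q \<ge> 2"
proof -
  have "card {0, 1 :: 'a} \<le> CARD('a)" by (rule card_mono) auto
  then show ?thesis by (simp add: q)
qed

lemma sum_e: "(\<Sum>y\<in>UNIV. e (y * z)) = (if z = 0 then of_nat q else 0)"
  using sum_trace_character[OF p card f \<zeta>, of z] by (simp add: q)

lemma e_0 [simp]: "e 0 = 1"
  using sum_e[of 0] q_ge_2 by (simp add: q)

lemma sum_enumeration: "(\<Sum>k<q. g (h k)) = (\<Sum>y\<in>UNIV. g y)"
  by (rule sum.reindex_bij_betw[OF bij])

lemma h_eq_iff: "i < q \<Longrightarrow> j < q \<Longrightarrow> h i = h j \<longleftrightarrow> i = j"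
  using bij by (auto simp: bij_betw_def inj_on_def)

lemma h_eq_0_iff: "i < q \<Longrightarrow> h i = 0 \<longleftrightarrow> i = 0"
  using h_eq_iff[of i 0] h0 by simp

lemma sum_shifted_character:
  "(\<Sum>y\<in>UNIV. (\<psi> (y + a) + s) * e (y * z)) =
     e (- a * z) * (if z = 0 then s * of_nat q else cnj (\<psi> z) * G)"
proof -
  have "(\<Sum>y\<in>UNIV. \<psi> (y + a) * e (y * z)) = (\<Sum>t\<in>UNIV. \<psi> t * e (- a * z + t * z))"
    by (rule sum.reindex_bij_witness[of _ "\<lambda>t. t - a" "\<lambda>y. y + a"]) (auto simp: algebra_simps)
  also have "\<dots> = (\<Sum>t\<in>UNIV. e (- a * z) * (\<psi> t * e (t * z)))"
    by (simp only: trace_character_add[OF p card \<zeta>] mult.left_commute)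
  also have "\<dots> = e (- a * z) * (cnj (\<psi> z) * G)"
    by (simp only: sum_distrib_left[symmetric]
        sum_character_trace_character[OF mc nontrivial p card f \<zeta>])
  finally have "(\<Sum>y\<in>UNIV. \<psi> (y + a) * e (y * z)) = e (- a * z) * (cnj (\<psi> z) * G)" .
  moreover have "(\<Sum>y\<in>UNIV. s * e (y * z)) = s * (if z = 0 then of_nat q else 0)"
    by (simp only: sum_distrib_left[symmetric] sum_e)
  ultimately show ?thesis
    by (simp add: distrib_right sum.distrib)
qed

text \<open>The columns of \<open>F 1\<close> are additive characters. Translating by
  \<open>u * h i\<close> multiplies them by \<open>e (- u * h i * h j)\<close>, hence
  \<open>F (- u)\<close> on the right.\<close>

lemma M_mult_F: "M u s * F 1 = F (- u) * mat q q (\<lambda>(i, j). if i = j then eigenvalue s i else 0)"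
  (is "_ = _ * ?D")
proof (rule eq_matI)
  fix i j assume "i < dim_row (F (- u) * ?D)" "j < dim_col (F (- u) * ?D)"
  then have ij: "i < q" "j < q" by (simp_all add: F_def)
  have "(M u s * F 1) $$ (i, j) = (\<Sum>k<q. M u s $$ (i, k) * F 1 $$ (k, j))"
    using ij by (intro index_mult_square_mat) auto
  also have "\<dots> = (\<Sum>k<q. (\<psi> (h k + u * h i) + s) * e (h k * h j))"
    using ij by (intro sum.cong) (auto simp: M_def F_def)
  also have "\<dots> = (\<Sum>y\<in>UNIV. (\<psi> (y + u * h i) + s) * e (y * h j))"
    by (rule sum_enumeration)
  also have "\<dots> = e (- u * h i * h j) * eigenvalue s j"
    using ij by (simp add: sum_shifted_character eigenvalue_def h_eq_0_iff)
  also have "\<dots> = (\<Sum>k<q. if k = j then e (- u * h i * h j) * eigenvalue s j else 0)"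
    using ij by simp
  also have "\<dots> = (\<Sum>k<q. F (- u) $$ (i, k) * ?D $$ (k, j))"
    using ij by (intro sum.cong) (auto simp: F_def)
  also have "\<dots> = (F (- u) * ?D) $$ (i, j)"
    using ij by (intro index_mult_square_mat[symmetric]) auto
  finally show "(M u s * F 1) $$ (i, j) = (F (- u) * ?D) $$ (i, j)" .
qed (simp_all add: M_def F_def)

lemma det_F_nonzero: "det (F 1) \<noteq> 0"
proof -
  have "F 1 * F (- 1) = of_nat q \<cdot>\<^sub>m 1\<^sub>m q"
  proof (rule eq_matI)
    fix i j assume "i < dim_row (of_nat q \<cdot>\<^sub>m 1\<^sub>m q :: complex mat)"
      "j < dim_col (of_nat q \<cdot>\<^sub>m 1\<^sub>m q :: complex mat)"
    then have ij: "i < q" "j < q" by simp_all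
    have "(F 1 * F (- 1)) $$ (i, j) = (\<Sum>k<q. F 1 $$ (i, k) * F (- 1) $$ (k, j))"
      using ij by (intro index_mult_square_mat) auto
    also have "\<dots> = (\<Sum>k<q. e (h k * (h i - h j)))"
      using ij by (intro sum.cong)
        (auto simp: F_def algebra_simps simp flip: trace_character_add[OF p card \<zeta>])
    also have "\<dots> = (\<Sum>y\<in>UNIV. e (y * (h i - h j)))"
      by (rule sum_enumeration)
    also have "\<dots> = (of_nat q \<cdot>\<^sub>m 1\<^sub>m q) $$ (i, j)"
      using ij by (simp add: sum_e h_eq_iff)
    finally show "(F 1 * F (- 1)) $$ (i, j) = (of_nat q \<cdot>\<^sub>m 1\<^sub>m q) $$ (i, j)" .
  qed (simp_all add: F_def)
  then have "det (F 1) * det (F (- 1)) = of_nat q ^ q"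
    using det_mult[of "F 1" q "F (- 1)"] by simp
  then show ?thesis by auto
qed

text \<open>Multiplicativity moves the product inside the character, where Wilson's theorem
  evaluates it to -1.\<close>

lemma prod_eigenvalue:
  "(\<Prod>i<q. eigenvalue s i) = s * of_nat q * (\<psi> (- 1) * G ^ (q - 1))"
proof -
  have nz: "bij_betw h ({..<q} - {0}) (UNIV - {0})"
    using bij_betw_DiffI[OF bij, of "{0}" "{0}"] q_ge_2 h0 by simp
  have "(\<Prod>i\<in>{..<q} - {0}. eigenvalue s i) = (\<Prod>i\<in>{..<q} - {0}. cnj (\<psi> (h i)) * G)"
    by (rule prod.cong) (auto simp: eigenvalue_def)
  also have "\<dots> = (\<Prod>x\<in>UNIV - {0}. cnj (\<psi> x) * G)"
    by (rule prod.reindex_bij_betw[OF nz])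
  also have "\<dots> = cnj (\<psi> (- 1)) * G ^ (q - 1)"
    by (simp add: prod.distrib card_Diff_singleton finite_field_wilson q
        flip: cnj_prod multiplicative_character_prod[OF mc])
  also have "cnj (\<psi> (- 1)) = \<psi> (- 1)"
  proof -
    have "\<psi> (- 1) * \<psi> (- 1) = 1" by (simp flip: multiplicative_character_mult[OF mc])
    moreover have "\<psi> (- 1) * cnj (\<psi> (- 1)) = 1"
      by (rule multiplicative_character_mult_cnj[OF mc]) simp
    ultimately show ?thesis by (metis mult_left_cancel mult_zero_left zero_neq_one)
  qed
  finally have "(\<Prod>i\<in>{..<q} - {0}. eigenvalue s i) = \<psi> (- 1) * G ^ (q - 1)" .
  then show ?thesis
    using q_ge_2 by (subst prod.remove[of _ 0]) (auto simp: eigenvalue_def)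
qed

text \<open>The factor \<open>\<kappa>\<close> stands for the sign of the row permutation
  \<open>x \<mapsto> - u * x\<close>; it is 1 for \<open>u = - 1\<close>.\<close>

lemma det_M:
  assumes "det (F (- u)) = \<kappa> * det (F 1)"
  shows "det (M u s) = \<kappa> * (s * of_nat q * (\<psi> (- 1) * G ^ (q - 1)))"
proof -
  let ?D = "mat q q (\<lambda>(i, j). if i = j then eigenvalue s i else 0)"
  have "det ?D = prod_list (diag_mat ?D)"
    by (rule det_upper_triangular[of _ q]) auto
  also have "\<dots> = (\<Prod>i<q. eigenvalue s i)"
    by (simp add: prod_list_diag_prod atLeast0LessThan)
  finally have D: "det ?D = (\<Prod>i<q. eigenvalue s i)" .
  have "det (M u s) * det (F 1) = det (F (- u)) * det ?D"
    using arg_cong[OF M_mult_F[of u s], of det] by (simp add: det_mult[of _ q])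
  then have "det (M u s) * det (F 1) = \<kappa> * det ?D * det (F 1)"
    using assms by simp
  then show ?thesis using det_F_nonzero by (simp add: D prod_eigenvalue)
qed

section \<open>The inverse of the shifted matrix and the minor without 0 and 1\<close>

text \<open>The correlation sums give the identity minus \<open>1 / q\<close> in every entry, and
  the mixed sums vanish. The constant \<open>1 / (s * q ^ 2)\<close> is chosen so that its product
  with \<open>s\<close>, summed over \<open>q\<close> terms, restores \<open>1 / q\<close>.\<close>

lemma M_inverse:
  assumes "s \<noteq> 0" "u \<noteq> 0"
  shows "M u s * mat q q (\<lambda>(i, j). cnj (\<psi> (h i + u * h j)) / of_nat q + 1 / (s * of_nat q ^ 2)) =
         1\<^sub>m q" (is "_ * ?N = _")
proof (rule eq_matI)
  fix i j assume "i < dim_row (1\<^sub>m q :: complex mat)" "j < dim_col (1\<^sub>m q :: complex mat)"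
  then have ij: "i < q" "j < q" by simp_all
  define a b c where "a = u * h i" and "b = u * h j" and "c = 1 / (s * of_nat q ^ 2)"
  have "(M u s * ?N) $$ (i, j) = (\<Sum>k<q. M u s $$ (i, k) * ?N $$ (k, j))"
    using ij by (intro index_mult_square_mat) auto
  also have "\<dots> = (\<Sum>k<q. (\<psi> (h k + a) + s) * (cnj (\<psi> (h k + b)) / of_nat q + c))"
    using ij by (intro sum.cong) (auto simp: M_def a_def b_def c_def)
  also have "\<dots> = (\<Sum>y\<in>UNIV. (\<psi> (y + a) + s) * (cnj (\<psi> (y + b)) / of_nat q + c))"
    by (rule sum_enumeration)
  also have "\<dots> = (\<Sum>y\<in>UNIV. \<psi> (y + a) * cnj (\<psi> (y + b))) / of_nat q
                + c * (\<Sum>y\<in>UNIV. \<psi> (y + a))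
                + s / of_nat q * (\<Sum>y\<in>UNIV. cnj (\<psi> (y + b))) + of_nat q * (s * c)"
    by (simp add: q algebra_simps add_divide_distrib sum.distrib sum_distrib_left sum_divide_distrib)
  also have "(\<Sum>y\<in>UNIV. \<psi> (y + a)) = (\<Sum>y\<in>UNIV. \<psi> y)"
    by (rule sum.reindex_bij_witness[of _ "\<lambda>y. y - a" "\<lambda>y. y + a"]) auto
  also have "(\<Sum>y\<in>UNIV. cnj (\<psi> (y + b))) = (\<Sum>y\<in>UNIV. cnj (\<psi> y))"
    by (rule sum.reindex_bij_witness[of _ "\<lambda>y. y - b" "\<lambda>y. y + b"]) auto
  finally have "(M u s * ?N) $$ (i, j) = (if a = b then of_nat q else 0) / of_nat q
      - 1 / of_nat q + of_nat q * (s * c)"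
    by (simp add: q sum_character_shift_cnj[OF mc nontrivial] sum_nontrivial_character[OF mc nontrivial]
        diff_divide_distrib flip: cnj_sum)
  moreover have "of_nat q * (s * c) = 1 / of_nat q"
    using assms by (simp add: c_def power2_eq_square field_simps)
  moreover have "a = b \<longleftrightarrow> i = j" using assms ij by (simp add: a_def b_def h_eq_iff)
  ultimately show "(M u s * ?N) $$ (i, j) = 1\<^sub>m q $$ (i, j)" using ij by simp
qed (simp_all add: M_def)

lemma det_minor:
  assumes "u \<noteq> 0" "det (F (- u)) = \<kappa> * det (F 1)"
  shows "det (mat (q - 2) (q - 2) (\<lambda>(i, j). \<psi> (h (j + 2) + u * h (i + 2)))) =
         \<kappa> * \<psi> (- 1) / of_nat q ^ 2 * (cnj (\<psi> (1 + u)) - cnj (\<psi> u) - 1) * G ^ (q - 1)"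
proof -
  let ?n = "q - 2"
  let ?d = "\<lambda>s. det (mat ?n ?n (\<lambda>(i, j). \<psi> (h (j + 2) + u * h (i + 2)) + s))"
  \<comment> \<open>The wanted value plus an error term linear in \<open>s\<close>.\<close>
  let ?r = "\<lambda>s. \<kappa> * \<psi> (- 1) / of_nat q ^ 2 * (cnj (\<psi> (1 + u)) - cnj (\<psi> u) - 1) * G ^ (q - 1)
                - s * (\<kappa> * (of_nat q * (\<psi> (- 1) * G ^ (q - 1))) * cnj (\<psi> u) / of_nat q ^ 2)"
  have eq: "?d s = ?r s" if s: "s \<noteq> 0" for s
  proof -
    define c where "c = 1 / (s * of_nat q ^ 2)"
    let ?N = "mat q q (\<lambda>(i, j). cnj (\<psi> (h i + u * h j)) / of_nat q + c)"
    let ?X = "mat 2 2 (\<lambda>(i, j). ?N $$ (i, j))"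
    have n: "2 + ?n = q" using q_ge_2 by simp
    have "det (mat ?n ?n (\<lambda>(i, j). M u s $$ (i + 2, j + 2))) = det (M u s) * det ?X"
      by (rule det_complementary_minor[where m = 2 and n = ?n, unfolded n])
         (use M_inverse[OF s assms(1)] in \<open>simp_all add: c_def\<close>)
    also have "mat ?n ?n (\<lambda>(i, j). M u s $$ (i + 2, j + 2)) =
               mat ?n ?n (\<lambda>(i, j). \<psi> (h (j + 2) + u * h (i + 2)) + s)"
      by (rule eq_matI) (auto simp: M_def)
    also have "det ?X = c * (cnj (\<psi> (1 + u)) / of_nat q + c) - (cnj (\<psi> u) / of_nat q + c) * (1 / of_nat q + c)"
      using q_ge_2 by (subst det_2x2) (auto simp: h0 h1[simplified])
    \<comment> \<open>The squares of \<open>c\<close> cancel. The remaining \<open>c\<close>, of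
      order \<open>1 / s\<close>, compensates the factor \<open>s\<close> of
      \<open>det (M u s)\<close>.\<close>
    also have "\<dots> = c * (cnj (\<psi> (1 + u)) - cnj (\<psi> u) - 1) / of_nat q - cnj (\<psi> u) / of_nat q ^ 2"
      by (simp add: algebra_simps add_divide_distrib diff_divide_distrib power2_eq_square)
    finally have "?d s = \<kappa> * (s * of_nat q * (\<psi> (- 1) * G ^ (q - 1))) *
        (c * (cnj (\<psi> (1 + u)) - cnj (\<psi> u) - 1) / of_nat q - cnj (\<psi> u) / of_nat q ^ 2)"
      by (simp only: det_M[OF assms(2)])
    moreover have "\<kappa> * (s * Q * (A * g)) * (c * W / Q - U / Q ^ 2) =
        \<kappa> * A / Q ^ 2 * W * g - s * (\<kappa> * (Q * (A * g)) * U / Q ^ 2)"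
      if "c = 1 / (s * Q ^ 2)" "Q \<noteq> 0" for A g W U Q
      using s that(2) by (simp add: that(1) field_simps power2_eq_square)
    moreover have "(of_nat q :: complex) \<noteq> 0" using q_ge_2 by simp
    ultimately show ?thesis using c_def by simp
  qed
  \<comment> \<open>The identity is known only for \<open>s \<noteq> 0\<close>; continuity of both
    sides carries it over to \<open>s = 0\<close>.\<close>
  have "(?d \<longlongrightarrow> ?d 0) (at 0)"
    using continuous_det_add_const[of ?n "\<lambda>i j. \<psi> (h (j + 2) + u * h (i + 2))"]
    unfolding continuous_on_def by (rule bspec) simp
  moreover have "eventually (\<lambda>s. ?d s = ?r s) (at 0)"
    using eq by (auto simp: eventually_at_filter)
  ultimately have "(?r \<longlongrightarrow> ?d 0) (at 0)"
    by (simp add: tendsto_cong)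
  moreover have "(?r \<longlongrightarrow> ?r 0) (at 0)"
    by (intro tendsto_intros)
  ultimately have "?d 0 = ?r 0" by (rule tendsto_unique[rotated]) simp
  then show ?thesis by simp
qed

text \<open>Negation permutes the rows. In odd characteristic it fixes only 0, so it consists of
  \<open>(q - 1) div 2\<close> transpositions.\<close>

lemma det_F_minus_one:
  assumes "odd q"
  shows "det (F (- 1)) = (- 1) ^ ((q - 1) div 2) * det (F 1)"
proof -
  \<comment> \<open>Negation of field elements, transported to indices.\<close>
  define \<pi> where "\<pi> i = (if i < q then inv_into {..<q} h (- h i) else i)" for i
  have \<pi>: "\<pi> i < q" "h (\<pi> i) = - h i" if "i < q" for i
    using that bij_betw_inv_into_right[OF bij, of "- h i"] inv_into_into[of "- h i" h "{..<q}"] bij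
    by (auto simp: \<pi>_def bij_betw_def)
  have \<pi>\<pi>: "\<pi> (\<pi> i) = i" if "i < q" for i
    using h_eq_iff[of "\<pi> (\<pi> i)" i] \<pi> that by simp
  have two: "(2 :: 'a) \<noteq> 0"
  proof
    assume "(2 :: 'a) = 0"
    then have "CHAR('a) dvd 2" by (metis of_nat_eq_0_iff_char_dvd of_nat_numeral)
    then have "CHAR('a) = 2" by (metis CHAR_not_1 One_nat_def prime_nat_iff two_is_prime_nat)
    moreover have "CHAR('a) dvd q" using CHAR_dvd_CARD[where 'a = 'a] by (simp add: q)
    ultimately show False using assms by simp
  qed
  have nofix: "\<pi> i \<noteq> i" "\<pi> i \<noteq> 0" if "i < q" "i \<noteq> 0" for i
  proof -
    have hi: "h i \<noteq> 0" using that h_eq_0_iff by simp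
    have "h i \<noteq> - h i"
    proof
      assume "h i = - h i"
      then have "2 * h i = 0" by (metis add.right_inverse mult_2)
      then show False using two hi by simp
    qed
    then show "\<pi> i \<noteq> i" using \<pi>(2)[OF that(1)] by metis
    show "\<pi> i \<noteq> 0" using \<pi>(2)[OF that(1)] hi h0 by (metis neg_equal_0_iff_equal)
  qed
  have \<pi>0: "\<pi> 0 = 0"
    using h_eq_0_iff[OF \<pi>(1)[of 0]] \<pi>(2)[of 0] h0 q_ge_2 by simp
  have perm: "\<pi> permutes {1..<q}"
  proof (rule bij_imp_permutes)
    show "bij_betw \<pi> {1..<q} {1..<q}"
      by (rule bij_betw_byWitness[where f' = \<pi>]) (use \<pi> \<pi>\<pi> nofix in \<open>force+\<close>)
    show "\<pi> i = i" if "i \<notin> {1..<q}" for i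
      using that \<pi>0 by (cases "i = 0") (auto simp: \<pi>_def)
  qed
  then have perm': "\<pi> permutes {0..<q}" by (rule permutes_subset) auto
  have sign: "sign \<pi> = (- 1) ^ ((q - 1) div 2)"
    using sign_fixpoint_free_involution[OF _ perm] \<pi>\<pi> nofix by simp
  have "F (- 1) = mat q q (\<lambda>(i, j). F 1 $$ (\<pi> i, j))"
    by (rule eq_matI) (simp_all add: F_def \<pi>)
  then show ?thesis
    using det_permute_rows[OF carrier(2) perm', of 1] by (simp add: sign)
qed

end

theorem theorem1p3:
  fixes p f q :: nat
    and x :: "nat \<Rightarrow> 'a::finite_field"
    and \<psi> :: "'a \<Rightarrow> complex"
    and \<zeta> :: complex
  assumes "prime p" and "q = p ^ f" and "q \<ge> 3" and "odd q"
    and "CARD('a) = q"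
    and "primitive_root_of_unity p \<zeta>"
    and "bij_betw x {1..q - 1} (UNIV - {0})" and "x 1 = 1"
    and "multiplicative_character \<psi>" and "nontrivial_character \<psi>"
  shows "det (D_minus q x \<psi>) =
           - ((1 + \<psi> (- 1)) / of_nat q ^ 2) * gauss_sum p f \<zeta> \<psi> ^ (q - 1) \<and>
         det (D_plus q x \<psi>) =
           (- 1) ^ ((q + 1) div 2) * \<psi> (- 1) / of_nat q ^ 2
             * (2 - cnj (\<psi> 2)) * gauss_sum p f \<zeta> \<psi> ^ (q - 1)"
proof -
  \<comment> \<open>The given enumeration starts at index 1, which leaves index 0 free for the zero
    of the field.\<close>
  define h where "h = x(0 := 0)"
  have "f > 0" using assms(2,3) by (cases f) auto
  have "bij_betw h ({0} \<union> {1..q - 1}) ({0} \<union> (UNIV - {0}))"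
  proof (rule bij_betw_combine)
    show "bij_betw h {0} {0}" by (simp add: h_def)
    show "bij_betw h {1..q - 1} (UNIV - {0})"
      using assms(7) by (rule bij_betw_cong[THEN iffD1, rotated]) (simp add: h_def)
  qed simp
  moreover have "{0} \<union> {1..q - 1} = {..<q}" using assms(3) by auto
  ultimately have "bij_betw h {..<q} UNIV" by simp
  then interpret E: enumerated_field_characters p f q h \<psi> \<zeta>
    using assms \<open>f > 0\<close> by unfold_locales (simp_all add: h_def)
  have D_minus: "D_minus q x \<psi> = mat (q - 2) (q - 2) (\<lambda>(i, j). \<psi> (h (j + 2) + (- 1) * h (i + 2)))"
    by (rule eq_matI) (auto simp: D_minus_def h_def)
  have D_plus: "D_plus q x \<psi> = mat (q - 2) (q - 2) (\<lambda>(i, j). \<psi> (h (j + 2) + 1 * h (i + 2)))"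
    by (rule eq_matI) (auto simp: D_plus_def h_def)
  have cnj: "\<psi> (- 1) * cnj (\<psi> (- 1)) = 1"
    by (rule multiplicative_character_mult_cnj[OF assms(9)]) simp
  \<comment> \<open>With \<open>u = - 1\<close> the entry at \<open>1 + u = 0\<close> vanishes and
    no rows are permuted.\<close>
  have "det (D_minus q x \<psi>) =
        \<psi> (- 1) * (- cnj (\<psi> (- 1)) - 1) / of_nat q ^ 2 * gauss_sum p f \<zeta> \<psi> ^ (q - 1)"
    using E.det_minor[of "- 1" 1] unfolding D_minus by simp
  also have "\<psi> (- 1) * (- cnj (\<psi> (- 1)) - 1) = - (1 + \<psi> (- 1))"
    using cnj by (simp add: algebra_simps)
  finally have "det (D_minus q x \<psi>) =
      - ((1 + \<psi> (- 1)) / of_nat q ^ 2) * gauss_sum p f \<zeta> \<psi> ^ (q - 1)"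
    by (simp only: minus_divide_left)
  moreover have "det (D_plus q x \<psi>) = (- 1) ^ ((q - 1) div 2) * \<psi> (- 1) / of_nat q ^ 2
      * (cnj (\<psi> 2) - 2) * gauss_sum p f \<zeta> \<psi> ^ (q - 1)"
    using E.det_minor[of 1 "(- 1) ^ ((q - 1) div 2)"] E.det_F_minus_one assms(4)
    unfolding D_plus by simp
  \<comment> \<open>The extra sign turns \<open>cnj (\<psi> 2) - 2\<close> into
    \<open>2 - cnj (\<psi> 2)\<close>.\<close>
  moreover have "(q + 1) div 2 = Suc ((q - 1) div 2)" using assms(3) by simp
  ultimately show ?thesis by (simp add: algebra_simps diff_divide_distrib)
qed

end
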